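(* Let $\mathcal{H}$ be a real Hilbert space, let $c:\mathcal{H}\to\mathbb{R}$ be convex and continuous, and let $C=\{x\in\mathcal{H}:c(x)\le 0\}$. Let $s\in\mathcal{H}$ satisfy $c(s)<0$. For any $\widetilde y\in\mathcal{H}$ define $$\lambda(\widetilde y)=\begin{cases}0,& c(\widetilde y)\le 0,\\[1mm] \dfrac{c(\widetilde y)}{c(\widetilde y)-c(s)},& c(\widetilde y)>0,\end{cases}\qquad y=(1-\lambda(\widetilde y))\,\widetilde y+\lambda(\widetilde y)\,s .$$ Then $y\in C$. *)

theory Defs
  imports "HOL-Analysis.Analysis"
begin

definition sublevel_set :: "('a \<Rightarrow> real) \<Rightarrow> 'a set" where
  "sublevel_set c = {x. c x \<le> 0}"

definition step_weight :: "('a \<Rightarrow> real) \<Rightarrow> 'a \<Rightarrow> 'a \<Rightarrow> real" where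
  "step_weight c s yt = (if c yt \<le> 0 then 0 else c yt / (c yt - c s))"

definition pull_back :: "('a::real_vector \<Rightarrow> real) \<Rightarrow> 'a \<Rightarrow> 'a \<Rightarrow> 'a" where
  "pull_back c s yt = (1 - step_weight c s yt) *\<^sub>R yt + step_weight c s yt *\<^sub>R s"

end

theory Submission
  imports Defs
begin

text \<open>If \<open>c yt \<le> 0\<close>, the weight is 0 and \<open>yt\<close> stays put.
  Otherwise the weight is exactly where the chord of \<open>c\<close> from \<open>yt\<close> to
  \<open>s\<close> crosses zero, and convexity (\<open>convex_onD\<close>) keeps \<open>c\<close>
  below that chord.\<close>

theorem lemma3p1:
  fixes c :: "'a::{real_inner, complete_space} \<Rightarrow> real" and s yt :: 'a
  assumes "convex_on UNIV c" and "continuous_on UNIV c"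
    and "c s < 0"
  shows "pull_back c s yt \<in> sublevel_set c"
proof (cases "c yt \<le> 0")
  case True
  then show ?thesis
    by (simp add: pull_back_def step_weight_def sublevel_set_def)
next
  case False
  define t where "t = c yt / (c yt - c s)"
  have pos: "c yt - c s > 0"
    using False assms(3) by simp
  \<comment> \<open>As \<open>c s < 0 < c yt\<close>, the denominator exceeds the positive
    numerator.\<close>
  have t: "0 \<le> t" "t \<le> 1"
    using False assms(3) pos by (simp_all add: t_def)
  have "c ((1 - t) *\<^sub>R yt + t *\<^sub>R s) \<le> (1 - t) * c yt + t * c s"
    using convex_onD[OF assms(1) t] by simp
  \<comment> \<open>Slope form of the chord: \<open>t\<close> is chosen so that the drop is exactly
    \<open>c yt\<close>.\<close>
  also have "\<dots> = c yt - t * (c yt - c s)"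
    by (simp add: algebra_simps)
  also have "\<dots> = 0"
    using pos by (simp add: t_def)
  finally show ?thesis
    using False by (simp add: pull_back_def step_weight_def sublevel_set_def t_def)
qed

end
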